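(* A real $2\times 2$ matrix $R$ satisfies $R^2=I_2$ if and only if it is one of the following: (1) $R=I_2$ or $R=-I_2$; (2) $R=\begin{bmatrix}1&b\\0&-1\end{bmatrix}$ or $R=\begin{bmatrix}-1&b\\0&1\end{bmatrix}$ for some $b\in\mathbb R$; (3) $R=\begin{bmatrix}1&0\\c&-1\end{bmatrix}$ or $R=\begin{bmatrix}-1&0\\c&1\end{bmatrix}$ for some $c\in\mathbb R$; (4) $R=\begin{bmatrix}a&b\\ \dfrac{1-a^2}{b}&-a\end{bmatrix}$ for some $a,b\in\mathbb R$ with $a^2\neq 1$ and $b\neq 0$.
   Context: $I_2$ denotes the $2\times 2$ identity matrix. A square root of a matrix $P$ is a matrix $R$ with $R^2=P$. *)

theory Defs
  imports "HOL-Analysis.Cartesian_Space"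
begin

end

theory Submission
  imports Defs
begin

text \<open>
  Write \<open>R\<close> with rows \<open>(p, q)\<close> and \<open>(r, s)\<close>. The off-diagonal entries of \<open>R\<^sup>2\<close> are
  \<open>q (p + s)\<close> and \<open>r (p + s)\<close>, so the trace \<open>p + s\<close> decides the shape of an involution.
  If the trace is nonzero, then \<open>R\<close> is diagonal with entries \<open>\<plusminus>1\<close>, and a nonzero trace forces
  them to be equal: \<open>R = \<plusminus>I\<close>. If the trace is zero, the diagonal entries of \<open>R\<^sup>2\<close> give the
  single further condition \<open>q r = 1 - p\<^sup>2\<close>. For \<open>p\<^sup>2 = 1\<close> one of \<open>q\<close>, \<open>r\<close> vanishes and \<open>R\<close> is
  triangular; for \<open>p\<^sup>2 \<noteq> 1\<close> neither vanishes, and \<open>r = (1 - p\<^sup>2) / q\<close>. The lemma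
  \<open>involution_2x2_iff\<close> is this dichotomy on the trace.
\<close>

lemma matrix_2x2_eq_iff:
  fixes A B :: "'a ^ 2 ^ 2"
  shows "A = B \<longleftrightarrow> A$1$1 = B$1$1 \<and> A$1$2 = B$1$2 \<and> A$2$1 = B$2$1 \<and> A$2$2 = B$2$2"
  by (auto simp: vec_eq_iff forall_2)

lemma involution_2x2_iff:
  fixes R :: "real ^ 2 ^ 2"
  shows "R ** R = mat 1 \<longleftrightarrow>
    R = mat 1 \<or> R = - mat 1 \<or> (R$2$2 = - R$1$1 \<and> R$1$2 * R$2$1 = 1 - (R$1$1)\<^sup>2)"
    (is "_ \<longleftrightarrow> ?rhs")
proof -
  let ?p = "R$1$1" and ?q = "R$1$2" and ?r = "R$2$1" and ?s = "R$2$2"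
  have entries: "R ** R = mat 1 \<longleftrightarrow>
      ?p * ?p + ?q * ?r = 1 \<and> ?q * (?p + ?s) = 0 \<and> ?r * (?p + ?s) = 0 \<and> ?r * ?q + ?s * ?s = 1"
    by (simp add: matrix_2x2_eq_iff matrix_matrix_mult_def sum_2 mat_def algebra_simps)
  show ?thesis
  proof
    assume "R ** R = mat 1"
    then have eqs: "?p * ?p + ?q * ?r = 1" "?q * (?p + ?s) = 0" "?r * (?p + ?s) = 0"
        "?r * ?q + ?s * ?s = 1"
      using entries by auto
    show ?rhs
    proof (cases "?p + ?s = 0")
      case True
      then have "?s = - ?p" by linarith
      with eqs(1) show ?thesis by (simp add: power2_eq_square algebra_simps)
    next
      case False
      then have off: "?q = 0" "?r = 0" using eqs by auto
      then have "?p * ?p = 1" "?s * ?s = 1" using eqs by auto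
      then have "?p = 1 \<or> ?p = -1" "?s = 1 \<or> ?s = -1"
        by (simp_all add: square_eq_1_iff)
      with False have "(?p = 1 \<and> ?s = 1) \<or> (?p = -1 \<and> ?s = -1)" by auto
      with off show ?thesis by (auto simp: matrix_2x2_eq_iff mat_def)
    qed
  next
    assume ?rhs
    then show "R ** R = mat 1"
      unfolding entries by (auto simp: mat_def power2_eq_square algebra_simps)
  qed
qed

theorem mainTheorem1:
  fixes R :: "real ^ 2 ^ 2"
  shows "R ** R = mat 1 \<longleftrightarrow>
      (R = mat 1 \<or> R = - mat 1)
    \<or> (\<exists>b::real. R = vector [vector [1, b], vector [0, -1]] \<or>
                 R = vector [vector [-1, b], vector [0, 1]])
    \<or> (\<exists>c::real. R = vector [vector [1, 0], vector [c, -1]] \<or>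
                 R = vector [vector [-1, 0], vector [c, 1]])
    \<or> (\<exists>a b::real. a\<^sup>2 \<noteq> 1 \<and> b \<noteq> 0 \<and>
                   R = vector [vector [a, b], vector [(1 - a\<^sup>2) / b, -a]])"
    (is "_ \<longleftrightarrow> ?rhs")
proof
  assume "R ** R = mat 1"
  then consider "R = mat 1 \<or> R = - mat 1"
    | "R$2$2 = - R$1$1" "R$1$2 * R$2$1 = 1 - (R$1$1)\<^sup>2"
    using involution_2x2_iff by blast
  then show ?rhs
  proof cases
    case 1
    then show ?thesis by blast
  next
    case tr0: 2
    show ?thesis
    proof (cases "(R$1$1)\<^sup>2 = 1")
      case True
      then have p: "R$1$1 = 1 \<or> R$1$1 = -1" by (simp add: power2_eq_1_iff)
      have "R$1$2 = 0 \<or> R$2$1 = 0" using tr0(2) True by simp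
      then show ?thesis
      proof
        assume "R$1$2 = 0"
        with p tr0(1) have "R = vector [vector [1, 0], vector [R$2$1, -1]] \<or>
            R = vector [vector [-1, 0], vector [R$2$1, 1]]"
          by (auto simp: matrix_2x2_eq_iff)
        then show ?thesis by blast
      next
        assume "R$2$1 = 0"
        with p tr0(1) have "R = vector [vector [1, R$1$2], vector [0, -1]] \<or>
            R = vector [vector [-1, R$1$2], vector [0, 1]]"
          by (auto simp: matrix_2x2_eq_iff)
        then show ?thesis by blast
      qed
    next
      case False
      then have "R$1$2 \<noteq> 0" using tr0(2) by auto
      moreover from this have
        "R = vector [vector [R$1$1, R$1$2], vector [(1 - (R$1$1)\<^sup>2) / R$1$2, - R$1$1]]"
        using tr0 by (simp add: matrix_2x2_eq_iff field_simps)
      ultimately show ?thesis using False by blast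
    qed
  qed
next
  assume ?rhs
  then show "R ** R = mat 1"
    unfolding involution_2x2_iff by auto
qed

end
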